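(* The only finite geometric lattice that has a two-element level is $M_2$.
   Context: A finite geometric lattice is graded; its $k$-th level is the set of elements of rank $k$. A two-element level means a level consisting of exactly two elements. $M_2$ denotes the four-element lattice consisting of a bottom, a top and two incomparable elements (atoms) between them. *)

theory Defs
  imports "HOL-Algebra.Lattice"
begin

definition covered_by :: "('a, 'b) gorder_scheme \<Rightarrow> 'a \<Rightarrow> 'a \<Rightarrow> bool" where
  "covered_by L x y \<longleftrightarrow> x \<in> carrier L \<and> y \<in> carrier L \<and> x \<sqsubset>\<^bsub>L\<^esub> y \<and>
     \<not> (\<exists>z \<in> carrier L. x \<sqsubset>\<^bsub>L\<^esub> z \<and> z \<sqsubset>\<^bsub>L\<^esub> y)"

definition atoms :: "('a, 'b) gorder_scheme \<Rightarrow> 'a set" where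
  "atoms L = {a. covered_by L \<bottom>\<^bsub>L\<^esub> a}"

text \<open>
  The base locale is the one for lattices whose equality is \<^term>\<open>(=)\<close>, with a bottom and a top;
  for a finite carrier the latter two only exclude the empty carrier. The bottom element is the
  join of the empty set of atoms, in line with \<open>atomistic\<close>.
\<close>

locale finite_geometric_lattice = bounded_lattice L for L (structure) +
  assumes finite_carrier: "finite (carrier L)"
    and atomistic: "x \<in> carrier L \<Longrightarrow> \<exists>A \<subseteq> atoms L. is_lub L x A"
    and semimodular: "\<lbrakk>x \<in> carrier L; y \<in> carrier L; covered_by L (x \<sqinter> y) x\<rbrakk>
      \<Longrightarrow> covered_by L y (x \<squnion> y)"

definition chains_below :: "('a, 'b) gorder_scheme \<Rightarrow> 'a \<Rightarrow> 'a set set" where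
  "chains_below L x = {C. C \<noteq> {} \<and> C \<subseteq> \<lbrace>\<bottom>\<^bsub>L\<^esub>..x\<rbrace>\<^bsub>L\<^esub> \<and>
     (\<forall>a\<in>C. \<forall>b\<in>C. a \<sqsubseteq>\<^bsub>L\<^esub> b \<or> b \<sqsubseteq>\<^bsub>L\<^esub> a)}"

text \<open>
  The rank (height) of an element of a finite lattice is the maximal length of a chain between
  the bottom and that element, a chain with \<open>n + 1\<close> elements having length \<open>n\<close>. In a
  graded lattice this is the common length of all maximal such chains.
\<close>

definition rank :: "('a, 'b) gorder_scheme \<Rightarrow> 'a \<Rightarrow> nat" where
  "rank L x = Max ((\<lambda>C. card C - 1) ` chains_below L x)"

definition level :: "('a, 'b) gorder_scheme \<Rightarrow> nat \<Rightarrow> 'a set" where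
  "level L k = {x \<in> carrier L. rank L x = k}"

definition has_two_element_level :: "('a, 'b) gorder_scheme \<Rightarrow> bool" where
  "has_two_element_level L \<longleftrightarrow> (\<exists>k. card (level L k) = 2)"

definition order_isomorphic :: "('a, 'c) gorder_scheme \<Rightarrow> ('b, 'd) gorder_scheme \<Rightarrow> bool" where
  "order_isomorphic L M \<longleftrightarrow>
     (\<exists>f. bij_betw f (carrier L) (carrier M) \<and> order_emb L M f)"

datatype m2 = Bot | Atom1 | Atom2 | Top

definition M2 :: "m2 gorder" where
  "M2 = \<lparr>carrier = UNIV, eq = (=), le = (\<lambda>x y. x = y \<or> x = Bot \<or> y = Top)\<rparr>"

end

theory Submission
  imports Defs
begin

text \<open>
  Semimodularity forces every chain inside an interval to be no longer than any given saturated
  chain through that interval: joining with the first element \<open>x'\<close> of the saturated chain above its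
  start merges at most one pair of elements of the chain. Hence covers raise the rank by exactly
  one, and every element of rank at most \<open>k\<close> lies below one of rank \<open>k\<close> as long as \<open>k\<close> is at
  most the rank of the top.

  Now let \<open>a \<noteq> b\<close> be the elements of level \<open>k\<close>; clearly \<open>k \<noteq> 0\<close>. Since elements are joins of
  atoms, there are atoms \<open>p \<sqsubseteq> a\<close>, \<open>q \<sqsubseteq> b\<close> with \<open>p\<close> not below \<open>b\<close> and \<open>q\<close> not below \<open>a\<close>. If
  \<open>k \<ge> 2\<close>, then \<open>p \<squnion> q\<close>, of rank 2, would lie below \<open>a\<close> or \<open>b\<close>, which is impossible. So
  \<open>k = 1\<close>, and a lattice with just two atoms in which every element is a join of atoms is \<open>M2\<close>.
\<close>

section \<open>Saturated chains and extremal elements in partial orders\<close>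

text \<open>As a relation, covering can be iterated: \<open>(x, y) \<in> covers L ^^ n\<close> says
  that a saturated chain of length \<open>n\<close> leads from \<open>x\<close> to
  \<open>y\<close>.\<close>

abbreviation covers :: "('a, 'b) gorder_scheme \<Rightarrow> ('a \<times> 'a) set" where
  "covers L \<equiv> {(x, y). covered_by L x y}"

lemma covered_byD:
  assumes "covered_by L x y"
  shows "x \<in> carrier L" "y \<in> carrier L" "x \<sqsubset>\<^bsub>L\<^esub> y" "x \<sqsubseteq>\<^bsub>L\<^esub> y"
  using assms by (auto simp: covered_by_def intro: lless_imp_le)

lemma covers_relpow_closed:
  assumes "(x, y) \<in> covers L ^^ n" "x \<in> carrier L"
  shows "y \<in> carrier L"
  using assms by (cases n) (auto simp: covered_byD(2))

lemma (in partial_order) covers_relpow_le: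
  assumes "(x, y) \<in> covers L ^^ n" "x \<in> carrier L"
  shows "x \<sqsubseteq> y"
  using assms
proof (induction n arbitrary: y)
  case (Suc n)
  then obtain z where "(x, z) \<in> covers L ^^ n" "covered_by L z y"
    by auto
  with Suc show ?case
    by (meson covered_byD le_trans)
qed simp

lemma (in partial_order) covered_by_between:
  assumes "covered_by L x y" "z \<in> carrier L" "x \<sqsubseteq> z" "z \<sqsubseteq> y"
  shows "z = x \<or> z = y"
  using assms by (auto simp: covered_by_def lless_eq)

lemma (in partial_order) ex_maximal:
  assumes "finite A" "A \<subseteq> carrier L" "A \<noteq> {}"
  shows "\<exists>m\<in>A. \<forall>x\<in>A. \<not> m \<sqsubset> x"
proof -
  have "asymp_on A (\<sqsubset>)" "transp_on A (\<sqsubset>)"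
    using assms(2) by (auto intro!: asymp_onI transp_onI simp: subset_iff
      elim: lless_antisym[where P = False, rotated 2] lless_trans)
  then show ?thesis
    using Finite_Set.bex_max_element[OF assms(1) _ _ assms(3)] lless_eq by metis
qed

lemma (in partial_order) ex_minimal:
  assumes "finite A" "A \<subseteq> carrier L" "A \<noteq> {}"
  shows "\<exists>m\<in>A. \<forall>x\<in>A. \<not> x \<sqsubset> m"
proof -
  have "asymp_on A (\<sqsubset>)" "transp_on A (\<sqsubset>)"
    using assms(2) by (auto intro!: asymp_onI transp_onI simp: subset_iff
      elim: lless_antisym[where P = False, rotated 2] lless_trans)
  then show ?thesis
    using Finite_Set.bex_min_element[OF assms(1) _ _ assms(3)] lless_eq by metis
qed

section \<open>Arbitrary chains against saturated chains\<close>

context finite_geometric_lattice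
begin

lemma ex_cover_below:
  assumes x: "x \<in> carrier L" and y: "y \<in> carrier L" and "x \<sqsubset> y"
  shows "\<exists>z. covered_by L x z \<and> z \<sqsubseteq> y"
proof -
  let ?A = "{z \<in> carrier L. x \<sqsubset> z \<and> z \<sqsubseteq> y}"
  have "?A \<noteq> {}" "finite ?A"
    using assms finite_carrier by auto
  then obtain m where m: "m \<in> ?A" "\<forall>z\<in>?A. \<not> z \<sqsubset> m"
    using ex_minimal[of ?A] by blast
  then have "covered_by L x m"
    unfolding covered_by_def using x y by (auto dest: lless_imp_le intro: le_trans)
  with m show ?thesis by blast
qed

lemma finite_chain:
  assumes "C \<subseteq> carrier L"
  shows "finite C"
  using assms finite_carrier finite_subset by blast

lemma chain_card_le_saturated:
  assumes "(x, y) \<in> covers L ^^ n" "x \<in> carrier L" "C \<subseteq> \<lbrace>x..y\<rbrace>"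
    and "\<And>a b. a \<in> C \<Longrightarrow> b \<in> C \<Longrightarrow> a \<sqsubseteq> b \<or> b \<sqsubseteq> a"
  shows "card C \<le> Suc n"
  using assms
proof (induction n arbitrary: x C)
  case 0
  then have "C \<subseteq> {x}"
    by (auto simp: at_least_at_most_def)
  then show ?case
    using card_mono[of "{x}" C] by simp
next
  case (Suc n)
  from Suc.prems(1) obtain x' where cov: "covered_by L x x'" and x'y: "(x', y) \<in> covers L ^^ n"
    by (blast elim: relpow_Suc_E2)
  note [simp] = covered_byD(1,2)[OF cov]
  have y [simp]: "y \<in> carrier L"
    using covers_relpow_closed[OF x'y] by simp
  have C: "c \<in> carrier L" "x \<sqsubseteq> c" "c \<sqsubseteq> y" if "c \<in> C" for c
    using Suc.prems(3) that by (auto simp: at_least_at_most_def)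
  have finC: "finite C"
    using C(1) by (intro finite_chain) auto
  have x'_le_y: "x' \<sqsubseteq> y"
    using covers_relpow_le[OF x'y] by simp
  \<comment> \<open>\<open>D\<close> is the part of the chain that joining with \<open>x'\<close>
    moves; if it is empty, the whole chain already lies in the shorter interval above
    \<open>x'\<close>.\<close>
  define D where "D = {c \<in> C. \<not> x' \<sqsubseteq> c}"
  show ?case
  proof (cases "D = {}")
    case True
    then have "C \<subseteq> \<lbrace>x'..y\<rbrace>"
      using C by (auto simp: D_def at_least_at_most_def)
    then have "card C \<le> Suc n"
      using Suc.IH[OF x'y] Suc.prems(4) by simp
    then show ?thesis by simp
  next
    case False
    have "finite D" "D \<subseteq> carrier L"
      using finC C by (auto simp: D_def)
    \<comment> \<open>\<open>m\<close> is the largest element of \<open>D\<close>, as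
      \<open>C\<close> is a chain. It is the one element whose removal makes \<open>f\<close>
      injective.\<close>
    then obtain m where m: "m \<in> D" "\<forall>d\<in>D. \<not> m \<sqsubset> d"
      using ex_maximal False by blast
    have mC: "m \<in> C" "\<not> x' \<sqsubseteq> m"
      using m by (auto simp: D_def)
    define f where "f c = c \<squnion> x'" for c
    have covf: "covered_by L c (f c)" if "c \<in> C" "\<not> x' \<sqsubseteq> c" for c
    proof -
      \<comment> \<open>The meet lies between \<open>x\<close> and its cover \<open>x'\<close> and
        differs from \<open>x'\<close>, so semimodularity applies.\<close>
      have "x' \<sqinter> c = x"
        using covered_by_between[OF cov, of "x' \<sqinter> c"] that C[OF that(1)]
          meet_le[of x x' c] meet_left[of x' c] meet_right[of x' c] covered_byD(4)[OF cov]
        by auto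
      then show ?thesis
        using semimodular[of x' c] cov that C by (simp add: f_def join_comm)
    qed
    \<comment> \<open>If \<open>f c = f d\<close> with \<open>c\<close> strictly below
      \<open>d\<close>, then \<open>c\<close> is in \<open>D\<close> and \<open>d\<close> is the
      cover \<open>f c\<close> of \<open>c\<close>. Since \<open>d\<close> is above
      \<open>x'\<close> and \<open>m\<close> is not, \<open>m\<close> lies between \<open>c\<close>
      and \<open>d\<close>, so it equals one of them.\<close>
    have sep: "f c \<noteq> f d" if cd: "c \<in> C - {m}" "d \<in> C - {m}" "c \<sqsubseteq> d" "c \<noteq> d" for c d
    proof
      assume eq: "f c = f d"
      have d_le: "d \<sqsubseteq> f c" and x'_le: "x' \<sqsubseteq> f c"
        unfolding eq using cd C join_left[of d x'] join_right[of d x'] by (auto simp: f_def)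
      have "\<not> x' \<sqsubseteq> c"
      proof
        assume "x' \<sqsubseteq> c"
        then have "f c = c"
          using le_iff_meet[of x' c] cd C by (simp add: f_def join_comm)
        then show False
          using d_le cd C le_antisym by auto
      qed
      then have cov_c: "covered_by L c (f c)" and "c \<in> D"
        using covf cd by (auto simp: D_def)
      have "d = f c"
        using covered_by_between[OF cov_c, of d] cd C d_le by auto
      then have "x' \<sqsubseteq> d"
        using x'_le by simp
      have "c \<sqsubseteq> m"
        using m \<open>c \<in> D\<close> Suc.prems(4)[of c m] cd mC by (auto simp: lless_eq)
      moreover have "m \<sqsubseteq> d"
        using Suc.prems(4)[of m d] cd mC C \<open>x' \<sqsubseteq> d\<close> le_trans[of x' d m] by auto
      ultimately have "m = c \<or> m = d"
        using covered_by_between[OF cov_c, of m] C mC \<open>d = f c\<close> by auto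
      then show False
        using cd by auto
    qed
    have "inj_on f (C - {m})"
    proof (rule inj_onI)
      fix c d assume "c \<in> C - {m}" "d \<in> C - {m}" "f c = f d"
      then show "c = d"
        using sep[of c d] sep[of d c] Suc.prems(4)[of c d] by auto
    qed
    moreover have "card (f ` C) \<le> Suc n"
    proof (rule Suc.IH[OF x'y])
      show "f ` C \<subseteq> \<lbrace>x'..y\<rbrace>"
        using C x'_le_y by (auto simp: f_def at_least_at_most_def intro: join_right join_le)
    next
      have mono: "f c \<sqsubseteq> f d" if "c \<in> C" "d \<in> C" "c \<sqsubseteq> d" for c d
        unfolding f_def using that C
        by (intro join_le) (auto intro: join_right le_trans[OF _ join_left])
      show "a \<sqsubseteq> b \<or> b \<sqsubseteq> a" if "a \<in> f ` C" "b \<in> f ` C" for a b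
        using that Suc.prems(4) mono by blast
    qed simp
    moreover have "card (f ` (C - {m})) \<le> card (f ` C)"
      using finC by (intro card_mono) auto
    ultimately have "card (C - {m}) \<le> Suc n"
      by (simp add: card_image)
    then show ?thesis
      using mC finC by simp
  qed
qed

section \<open>Rank as the length of saturated chains\<close>

lemma finite_chains_below: "finite (chains_below L x)"
  by (rule finite_subset[of _ "Pow (carrier L)"])
    (use finite_carrier in \<open>auto simp: chains_below_def at_least_at_most_def\<close>)

lemma bottom_in_chains_below:
  assumes "x \<in> carrier L"
  shows "{\<bottom>} \<in> chains_below L x"
  using assms by (auto simp: chains_below_def at_least_at_most_def)

lemma rank_ge:
  assumes "C \<in> chains_below L x"
  shows "card C - 1 \<le> rank L x"
  using assms finite_chains_below unfolding rank_def by (intro Max_ge) auto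

lemma rank_attained:
  assumes "x \<in> carrier L"
  obtains C where "C \<in> chains_below L x" "card C = Suc (rank L x)"
proof -
  have "rank L x \<in> (\<lambda>C. card C - 1) ` chains_below L x"
    unfolding rank_def using finite_chains_below bottom_in_chains_below[OF assms]
    by (intro Max_in) auto
  then obtain C where C: "C \<in> chains_below L x" "rank L x = card C - 1"
    by blast
  \<comment> \<open>Finite nonempty chains have positive cardinality, so the subtraction in
    \<open>rank\<close> does not truncate.\<close>
  have "finite C" "C \<noteq> {}"
    using C(1) by (auto simp: chains_below_def at_least_at_most_def intro!: finite_chain)
  then have "card C > 0"
    by (simp add: card_gt_0_iff)
  then show thesis
    using C that by simp
qed

text \<open>A longest chain below \<open>x\<close> becomes a longer chain below \<open>y\<close>
  when \<open>y\<close> is added.\<close>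

lemma rank_strict_mono:
  assumes x: "x \<in> carrier L" and y: "y \<in> carrier L" and xy: "x \<sqsubset> y"
  shows "rank L x < rank L y"
proof -
  obtain C where C: "C \<in> chains_below L x" "card C = Suc (rank L x)"
    using rank_attained x by blast
  have Cx: "c \<in> carrier L" "c \<sqsubseteq> x" if "c \<in> C" for c
    using C that by (auto simp: chains_below_def at_least_at_most_def)
  have Cy: "c \<sqsubseteq> y" if "c \<in> C" for c
    using Cx[OF that] x y xy le_trans lless_imp_le by metis
  have "y \<notin> C"
    using Cx x y xy by (auto simp: lless_eq)
  moreover have "insert y C \<in> chains_below L y"
    using C(1) Cx Cy y by (auto simp: chains_below_def at_least_at_most_def)
  moreover have "finite C"
    using Cx by (intro finite_chain) auto
  ultimately show ?thesis
    using rank_ge[of "insert y C" y] C(2) by simp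
qed

lemma rank_mono:
  assumes "x \<in> carrier L" "y \<in> carrier L" "x \<sqsubseteq> y"
  shows "rank L x \<le> rank L y"
  using assms rank_strict_mono[of x y] by (cases "x = y") (auto simp: lless_eq)

text \<open>The Jordan-Dedekind property: the length of a saturated chain from the bottom bounds all
  chains below \<open>x\<close>, while rank grows by at least one at each of its covers.\<close>

lemma rank_saturated:
  assumes "(\<bottom>, x) \<in> covers L ^^ n"
  shows "rank L x = n"
proof (rule antisym)
  have x: "x \<in> carrier L"
    using covers_relpow_closed[OF assms] by simp
  obtain C where "C \<in> chains_below L x" "card C = Suc (rank L x)"
    using rank_attained x by blast
  then show "rank L x \<le> n"
    using chain_card_le_saturated[OF assms, of C] by (auto simp: chains_below_def)
next
  show "n \<le> rank L x"
    using assms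
  proof (induction n arbitrary: x)
    case (Suc n)
    then obtain z where z: "(\<bottom>, z) \<in> covers L ^^ n" "covered_by L z x"
      by auto
    then have "rank L z < rank L x"
      using rank_strict_mono covered_byD[OF z(2)] by simp
    with Suc.IH[OF z(1)] show ?case
      by simp
  qed simp
qed

lemma saturated_chain_exists:
  assumes "x \<in> carrier L" "y \<in> carrier L" "x \<sqsubseteq> y"
  shows "\<exists>n. (x, y) \<in> covers L ^^ n"
  using assms
proof (induction "rank L y - rank L x" arbitrary: x rule: less_induct)
  case less
  show ?case
  proof (cases "x = y")
    case True
    then show ?thesis using relpow_0_I by metis
  next
    case False
    then obtain z where z: "covered_by L x z" "z \<sqsubseteq> y"
      using ex_cover_below less.prems by (auto simp: lless_eq)
    \<comment> \<open>The second bound guarantees that the truncated difference of ranks really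
      drops.\<close>
    then have "rank L x < rank L z" "rank L z \<le> rank L y"
      using covered_byD[OF z(1)] less.prems rank_strict_mono rank_mono by auto
    then have "rank L y - rank L z < rank L y - rank L x"
      by simp
    then obtain n where n: "(z, y) \<in> covers L ^^ n"
      using less.hyps z(2) less.prems(2) covered_byD(2)[OF z(1)] by blast
    then have "(x, y) \<in> covers L ^^ Suc n"
      using z(1) by (intro relpow_Suc_I2[OF _ n]) simp
    then show ?thesis by blast
  qed
qed

text \<open>A saturated chain up to \<open>x\<close> is prolonged by the cover to a saturated chain
  up to \<open>y\<close>.\<close>

lemma rank_covered_by:
  assumes "covered_by L x y"
  shows "rank L y = Suc (rank L x)"
proof -
  obtain n where n: "(\<bottom>, x) \<in> covers L ^^ n"
    using saturated_chain_exists covered_byD[OF assms] by blast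
  have "(\<bottom>, y) \<in> covers L ^^ Suc n"
    using assms by (intro relpow_Suc_I[OF n]) simp
  then have "rank L y = Suc n"
    by (rule rank_saturated)
  with rank_saturated[OF n] show ?thesis
    by simp
qed

lemma rank_bottom [simp]: "rank L \<bottom> = 0"
  by (rule rank_saturated) simp

lemma rank_eq_0_iff:
  assumes "x \<in> carrier L"
  shows "rank L x = 0 \<longleftrightarrow> x = \<bottom>"
proof
  assume "rank L x = 0"
  then have "\<not> \<bottom> \<sqsubset> x"
    using rank_strict_mono[OF bottom_closed assms] by auto
  then show "x = \<bottom>"
    using bottom_lower[OF assms] unfolding lless_eq by metis
qed simp

section \<open>Levels, atoms and joins of atoms\<close>

lemma level_1: "level L 1 = atoms L"
proof (intro Set.set_eqI iffI)
  fix x assume "x \<in> level L 1"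
  then have x: "x \<in> carrier L" "rank L x = 1"
    by (auto simp: level_def)
  then have "x \<noteq> \<bottom>" by auto
  then obtain z where z: "covered_by L \<bottom> z" "z \<sqsubseteq> x"
    using ex_cover_below[of \<bottom> x] x by (auto simp: lless_eq)
  \<comment> \<open>Both elements have rank 1, which rules out \<open>z\<close> being strictly below
    \<open>x\<close>.\<close>
  then have "z = x"
    using rank_covered_by[OF z(1)] rank_strict_mono[of z x] x covered_byD[OF z(1)]
    by (auto simp: lless_eq)
  with z show "x \<in> atoms L"
    by (simp add: atoms_def)
next
  fix x assume "x \<in> atoms L"
  then show "x \<in> level L 1"
    using rank_covered_by[of \<bottom> x] by (auto simp: atoms_def level_def covered_byD)
qed

text \<open>Climbing along covers raises the rank in steps of one, so rank \<open>k\<close> is not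
  skipped; the bound on \<open>k\<close> keeps the climb from ending early at the top.\<close>

lemma ex_above_of_rank:
  assumes "x \<in> carrier L" "rank L x \<le> k" "k \<le> rank L \<top>"
  shows "\<exists>y\<in>level L k. x \<sqsubseteq> y"
  using assms
proof (induction "k - rank L x" arbitrary: x)
  case 0
  then show ?case by (auto simp: level_def)
next
  case (Suc n)
  then have "x \<noteq> \<top>" by auto
  then obtain z where z: "covered_by L x z"
    using ex_cover_below[of x \<top>] Suc.prems by (auto simp: lless_eq)
  then have "n = k - rank L z" "rank L z \<le> k"
    using Suc.hyps(2) rank_covered_by[OF z] by auto
  then obtain y where "y \<in> level L k" "z \<sqsubseteq> y"
    using Suc.hyps(1) Suc.prems(3) covered_byD(2)[OF z] by blast
  moreover have "y \<in> carrier L"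
    using \<open>y \<in> level L k\<close> by (simp add: level_def)
  ultimately show ?case
    using covered_byD[OF z] le_trans by blast
qed

text \<open>\<open>x\<close> is the join of a set of atoms; if all atoms below \<open>x\<close> were
  below \<open>y\<close>, then \<open>y\<close> would be an upper bound of that set and hence above
  \<open>x\<close>.\<close>

lemma ex_separating_atom:
  assumes "x \<in> carrier L" "y \<in> carrier L" "\<not> x \<sqsubseteq> y"
  shows "\<exists>p\<in>atoms L. p \<sqsubseteq> x \<and> \<not> p \<sqsubseteq> y"
proof (rule ccontr)
  assume contra: "\<not> ?thesis"
  obtain A where A: "A \<subseteq> atoms L" "is_lub L x A"
    using atomistic assms by blast
  then have "A \<subseteq> carrier L"
    by (auto simp: atoms_def covered_byD)
  then have "y \<in> Upper L A"
    using A contra assms least_Upper_above[OF A(2)] by (auto intro!: Upper_memI)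
  then show False
    using least_le A assms by metis
qed

text \<open>Distinct atoms meet in the bottom, so semimodularity turns the cover of the bottom by
  \<open>p\<close> into a cover of \<open>q\<close> by \<open>p \<squnion> q\<close>.\<close>

lemma atom_join_rank:
  assumes p: "p \<in> atoms L" and q: "q \<in> atoms L" and "p \<noteq> q"
  shows "rank L (p \<squnion> q) = 2"
proof -
  have pq: "covered_by L \<bottom> p" "covered_by L \<bottom> q"
    using p q by (auto simp: atoms_def)
  note [simp] = pq[THEN covered_byD(2)]
  have "p \<sqinter> q = \<bottom>"
  proof -
    have "p \<sqinter> q \<in> {\<bottom>, p}" "p \<sqinter> q \<in> {\<bottom>, q}"
      using covered_by_between[OF pq(1), of "p \<sqinter> q"] covered_by_between[OF pq(2), of "p \<sqinter> q"]
        meet_left[of p q] meet_right[of p q] by auto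
    then show ?thesis
      using \<open>p \<noteq> q\<close> by auto
  qed
  then have "covered_by L q (p \<squnion> q)"
    using semimodular[of p q] pq by simp
  then show ?thesis
    using rank_covered_by pq by fastforce
qed

lemma level_incomparable:
  assumes "a \<in> level L k" "b \<in> level L k" "a \<sqsubseteq> b"
  shows "a = b"
  using assms rank_strict_mono[of a b] by (auto simp: level_def lless_eq)

section \<open>Lattices with a two-element level\<close>

lemma two_element_level_index:
  assumes "level L k = {a, b}" "a \<noteq> b"
  shows "k = 1"
proof -
  have ab: "a \<in> level L k" "b \<in> level L k"
    using assms by auto
  then have carr [simp]: "a \<in> carrier L" "b \<in> carrier L"
    by (auto simp: level_def)
  have rk: "rank L a = k" "rank L b = k"
    using ab by (auto simp: level_def)
  have "k \<noteq> 0"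
    using rk rank_eq_0_iff assms(2) carr by metis
  moreover have "\<not> 2 \<le> k"
  proof
    assume "2 \<le> k"
    have "\<not> a \<sqsubseteq> b" "\<not> b \<sqsubseteq> a"
      using level_incomparable ab assms(2) by blast+
    then obtain p where p: "p \<in> atoms L" "p \<sqsubseteq> a" "\<not> p \<sqsubseteq> b"
      using ex_separating_atom carr by blast
    obtain q where q: "q \<in> atoms L" "q \<sqsubseteq> b" "\<not> q \<sqsubseteq> a"
      using ex_separating_atom carr \<open>\<not> b \<sqsubseteq> a\<close> by blast
    have [simp]: "p \<in> carrier L" "q \<in> carrier L"
      using p q by (auto simp: atoms_def covered_byD)
    have "rank L (p \<squnion> q) = 2"
      using atom_join_rank p q by blast
    moreover have "k \<le> rank L \<top>"
      using rank_mono[of a \<top>] rk by simp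
    \<comment> \<open>The level offers only \<open>a\<close> and \<open>b\<close> as
      \<open>c\<close>, but \<open>q\<close> is not below \<open>a\<close> and \<open>p\<close> is
      not below \<open>b\<close>.\<close>
    ultimately obtain c where c: "c \<in> {a, b}" "p \<squnion> q \<sqsubseteq> c"
      using ex_above_of_rank[of "p \<squnion> q" k] \<open>2 \<le> k\<close> assms(1) by auto
    have "c \<in> carrier L"
      using c by auto
    then have "p \<sqsubseteq> c" "q \<sqsubseteq> c"
      using c(2) le_trans[OF join_left[of p q]] le_trans[OF join_right[of p q]] by auto
    then show False
      using c p q by auto
  qed
  ultimately show ?thesis by linarith
qed

lemma carrier_two_atoms:
  assumes at: "atoms L = {a, b}"
  shows "carrier L = {\<bottom>, a, b, \<top>}"
proof
  have "a \<in> atoms L" "b \<in> atoms L"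
    using at by auto
  then have [simp]: "a \<in> carrier L" "b \<in> carrier L"
    by (auto simp: atoms_def covered_byD)
  then show "{\<bottom>, a, b, \<top>} \<subseteq> carrier L"
    by auto
  show "carrier L \<subseteq> {\<bottom>, a, b, \<top>}"
  proof
    fix x assume "x \<in> carrier L"
    then obtain A where A: "A \<subseteq> {a, b}" "is_lub L x A"
      using atomistic[of x] unfolding at by meson
    \<comment> \<open>The top is itself a join of some of the two atoms, so a common upper bound of
      \<open>a\<close> and \<open>b\<close> bounds \<open>T\<close> and must be the top.\<close>
    obtain T where T: "T \<subseteq> {a, b}" "is_lub L \<top> T"
      using atomistic[OF top_closed] unfolding at by meson
    consider "A = {}" | "A = {a}" | "A = {b}" | "A = {a, b}"
      using A(1) by blast
    then show "x \<in> {\<bottom>, a, b, \<top>}"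
    proof cases
      case 1
      then show ?thesis
        using A least_unique bottom_least by auto
    next
      case 4
      have "x \<in> Upper L T"
        using Upper_antimono[OF T(1), of L] least_mem[OF A(2)] 4 by auto
      then have "x = \<top>"
        using least_le[OF T(2)] \<open>x \<in> carrier L\<close> le_antisym by auto
      then show ?thesis by simp
    qed (use A least_unique sup_of_singletonI in auto)
  qed
qed

text \<open>The hypothesis on \<open>M2\<close> is a conjunct of \<open>order_emb\<close>; it is
  discharged once \<open>M2\<close> has been shown to be a lattice.\<close>

lemma two_atoms_isomorphic_M2:
  assumes at: "atoms L = {a, b}" and ne: "a \<noteq> b" and M2: "weak_partial_order M2"
  shows "order_isomorphic L M2"
proof -
  have lev: "a \<in> level L 1" "b \<in> level L 1"
    using at level_1 by auto
  then have [simp]: "a \<in> carrier L" "b \<in> carrier L" and rk: "rank L a = 1" "rank L b = 1"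
    by (auto simp: level_def)
  have nle: "\<not> a \<sqsubseteq> b" "\<not> b \<sqsubseteq> a"
    using level_incomparable lev ne by auto
  then have dist: "a \<noteq> \<bottom>" "b \<noteq> \<bottom>" "a \<noteq> \<top>" "b \<noteq> \<top>"
    by auto
  have "\<bottom> \<noteq> \<top>"
    using dist bottom_lower top_higher le_antisym by (metis \<open>a \<in> carrier L\<close> bottom_closed)
  have nbot: "\<not> x \<sqsubseteq> \<bottom>" if "x \<in> carrier L" "x \<noteq> \<bottom>" for x
    using that le_antisym by auto
  have ntop: "\<not> \<top> \<sqsubseteq> x" if "x \<in> carrier L" "x \<noteq> \<top>" for x
    using that le_antisym by auto
  \<comment> \<open>On the carrier only the top reaches the last branch, because the bottom, the two
    atoms and the top exhaust it.\<close>
  define f where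
    "f x = (if x = \<bottom> then Bot else if x = a then Atom1 else if x = b then Atom2 else Top)" for x
  have f: "f \<bottom> = Bot" "f a = Atom1" "f b = Atom2" "f \<top> = Top"
    using dist ne \<open>\<bottom> \<noteq> \<top>\<close> by (auto simp: f_def)
  have "f ` carrier L = UNIV"
    using f carrier_two_atoms[OF at] by (auto intro: m2.exhaust)
  moreover have "inj_on f (carrier L)"
    using f unfolding carrier_two_atoms[OF at] by (auto simp: inj_on_def)
  ultimately have "bij_betw f (carrier L) (carrier M2)"
    by (simp add: bij_betw_def M2_def)
  moreover have "order_emb L M2 f"
    unfolding order_emb_def
  proof (intro conjI ballI)
    fix x y assume "x \<in> carrier L" "y \<in> carrier L"
    then have "x \<in> {\<bottom>, a, b, \<top>}" "y \<in> {\<bottom>, a, b, \<top>}"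
      using carrier_two_atoms[OF at] by auto
    then show "f x \<sqsubseteq>\<^bsub>M2\<^esub> f y \<longleftrightarrow> x \<sqsubseteq> y"
      using f nle dist \<open>\<bottom> \<noteq> \<top>\<close> nbot ntop by (auto simp: M2_def)
  qed (use M2 weak_partial_order_axioms in auto)
  ultimately show ?thesis
    unfolding order_isomorphic_def by blast
qed

end

section \<open>The lattice \<open>M2\<close>\<close>

lemma M2_simps [simp]:
  "carrier M2 = UNIV"
  "x .=\<^bsub>M2\<^esub> y \<longleftrightarrow> x = y"
  "x \<sqsubseteq>\<^bsub>M2\<^esub> y \<longleftrightarrow> x = y \<or> x = Bot \<or> y = Top"
  by (auto simp: M2_def)

lemma UNIV_m2: "UNIV = {Bot, Atom1, Atom2, Top}"
  using m2.exhaust by auto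

lemma partial_order_M2: "partial_order M2"
  by unfold_locales (auto simp: M2_def)

text \<open>The two atoms are the only incomparable pair, and \<open>Top\<close> is their only
  common upper bound.\<close>

lemma is_lub_M2:
  "is_lub M2 (if x \<sqsubseteq>\<^bsub>M2\<^esub> y then y else if y \<sqsubseteq>\<^bsub>M2\<^esub> x then x else Top) {x, y}"
  by (cases x; cases y) (auto simp: least_def Upper_def)

lemma is_glb_M2:
  "is_glb M2 (if x \<sqsubseteq>\<^bsub>M2\<^esub> y then x else if y \<sqsubseteq>\<^bsub>M2\<^esub> x then y else Bot) {x, y}"
  by (cases x; cases y) (auto simp: greatest_def Lower_def)

lemma bounded_lattice_M2: "bounded_lattice M2"
proof -
  interpret partial_order M2
    by (fact partial_order_M2)
  show ?thesis
  proof unfold_locales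
    show "\<exists>x. least M2 x (carrier M2)"
      by (rule exI[of _ Bot]) (auto simp: least_def)
    show "\<exists>x. greatest M2 x (carrier M2)"
      by (rule exI[of _ Top]) (auto simp: greatest_def)
  qed (use is_lub_M2 is_glb_M2 in blast)+
qed

interpretation M2: bounded_lattice M2
  by (fact bounded_lattice_M2)

lemma join_M2: "x \<squnion>\<^bsub>M2\<^esub> y = (if x \<sqsubseteq>\<^bsub>M2\<^esub> y then y else if y \<sqsubseteq>\<^bsub>M2\<^esub> x then x else Top)"
  by (rule M2.joinI) (rule M2.least_unique[OF _ is_lub_M2], simp_all)

lemma meet_M2: "x \<sqinter>\<^bsub>M2\<^esub> y = (if x \<sqsubseteq>\<^bsub>M2\<^esub> y then x else if y \<sqsubseteq>\<^bsub>M2\<^esub> x then y else Bot)"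
  by (rule M2.meetI) (rule M2.greatest_unique[OF _ is_glb_M2], simp_all)

lemma bottom_M2: "\<bottom>\<^bsub>M2\<^esub> = Bot"
  by (rule M2.bottom_eq[symmetric]) auto

lemma covered_by_M2:
  "covered_by M2 x y \<longleftrightarrow> x \<noteq> y \<and> (x = Bot \<and> y \<noteq> Top \<or> x \<noteq> Bot \<and> y = Top)"
  by (cases x; cases y) (auto simp: covered_by_def M2.lless_eq)

lemma atoms_M2: "atoms M2 = {Atom1, Atom2}"
proof (rule Set.set_eqI)
  show "x \<in> atoms M2 \<longleftrightarrow> x \<in> {Atom1, Atom2}" for x
    by (cases x) (auto simp: atoms_def bottom_M2 covered_by_M2)
qed

lemma finite_geometric_lattice_M2: "finite_geometric_lattice M2"
proof unfold_locales
  show "finite (carrier M2)"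
    by (simp add: UNIV_m2)
  \<comment> \<open>The bottom is the empty join, the top is the join of both atoms, and each atom
    is the join of itself.\<close>
  show "\<exists>A\<subseteq>atoms M2. is_lub M2 x A" for x
  proof (cases x)
    case Bot
    then show ?thesis
      by (intro exI[of _ "{}"]) (auto simp: least_def)
  next
    case Top
    then show ?thesis
      using is_lub_M2[of Atom1 Atom2] by (intro exI[of _ "{Atom1, Atom2}"]) (auto simp: atoms_M2)
  qed (use is_lub_M2[of x x] in \<open>auto simp: atoms_M2 intro!: exI[of _ "{x}"]\<close>)
  show "covered_by M2 y (x \<squnion>\<^bsub>M2\<^esub> y)" if "covered_by M2 (x \<sqinter>\<^bsub>M2\<^esub> y) x" for x y
    using that by (cases x; cases y) (auto simp: covered_by_M2 join_M2 meet_M2)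
qed

theorem theorem2:
  shows "finite_geometric_lattice M2 \<and> has_two_element_level M2 \<and>
    (\<forall>L :: ('a, 'b) gorder_scheme.
       finite_geometric_lattice L \<and> has_two_element_level L \<longrightarrow> order_isomorphic L M2)"
proof (intro conjI allI impI)
  show "finite_geometric_lattice M2"
    by (fact finite_geometric_lattice_M2)
  \<comment> \<open>The general description of level 1 as the set of atoms replaces a computation of
    ranks in \<open>M2\<close>.\<close>
  have "card (level M2 1) = 2"
    using finite_geometric_lattice.level_1[OF finite_geometric_lattice_M2] by (simp add: atoms_M2)
  then show "has_two_element_level M2"
    unfolding has_two_element_level_def by blast
next
  fix L :: "('a, 'b) gorder_scheme"
  assume L: "finite_geometric_lattice L \<and> has_two_element_level L"
  then interpret finite_geometric_lattice L
    by simp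
  obtain k a b where k: "level L k = {a, b}" "a \<noteq> b"
    using L unfolding has_two_element_level_def card_2_iff by blast
  then have "atoms L = {a, b}"
    using two_element_level_index level_1 by metis
  then show "order_isomorphic L M2"
    using two_atoms_isomorphic_M2 k(2) M2.weak_partial_order_axioms by blast
qed

end
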